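(* Let $(\mathcal{M}, g, A)$ be a K\"ahler manifold with a quarter-symmetric metric $A$-connection $\overset{1}{\nabla}_XY=\overset{g}{\nabla}_XY-\pi(X)AY$ with generator $\pi$. The tensor $$\overset{3}{H}(X,Y)Z=\overset{3}{R}(X,Y)Z+\overset{3}{R}ic(Y,AX)\,AZ+\overset{3}{'R}(AZ,Y)\,AX$$ is independent of the generator $\pi$; that is, for any two 1-forms $\pi,\tilde\pi$ on $\mathcal{M}$, the tensors $\overset{3}{H}$ constructed from $\pi$ and from $\tilde\pi$ coincide.
   Context: A K\"ahler manifold $(\mathcal{M},g,A)$ is a Riemannian manifold $(\mathcal{M},g)$ of dimension $n=2k\ge4$ with a $(1,1)$ tensor field $A$ satisfying $A^2=-I$, $g(AX,AY)=g(X,Y)$ and $\overset{g}{\nabla}A=0$, where $\overset{g}{\nabla}$ is the Levi-Civita connection. $\overset{g}{R}$ is the Riemannian curvature tensor of $g$, $\overset{g}{R}(X,Y)Z=\overset{g}{\nabla}_X\overset{g}{\nabla}_YZ-\overset{g}{\nabla}_Y\overset{g}{\nabla}_XZ-\overset{g}{\nabla}_{[X,Y]}Z$. For a 1-form $\pi$ (the generator), the curvature tensor of the third kind is $$\overset{3}{R}(X,Y)Z=\overset{g}{R}(X,Y)Z-\overset{2}{D}(X,Y)AZ+\overset{3}{D}(Y,Z)AX,$$ where $\overset{2}{D}(X,Y)=(\overset{g}{\nabla}_X\pi)(Y)+\pi(Y)\pi(AX)$ and $\overset{3}{D}(X,Y)=(\overset{g}{\nabla}_X\pi)(Y)+\pi(X)\pi(AY)$.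 Moreover $\overset{3}{R}ic(Y,Z)=\mathrm{Trace}\{X\mapsto\overset{3}{R}(X,Y)Z\}$ and $\overset{3}{'R}(X,Y)=\mathrm{Trace}\{Z\mapsto\overset{3}{R}(X,Y)Z\}$. *)

theory Defs
  imports "HOL-Analysis.Analysis" "HOL-Library.Function_Algebras"
begin

section \<open>Smooth maps between Euclidean spaces\<close>

text \<open>Intended for open \<^term>\<open>S\<close> and a finite-dimensional domain, where having all iterated directional
  derivatives, differentiable at each stage, is the same as being infinitely differentiable.\<close>

fun Ck_on :: "nat \<Rightarrow> 'e::euclidean_space set \<Rightarrow> ('e \<Rightarrow> 'b::real_normed_vector) \<Rightarrow> bool" where
  "Ck_on 0 S f \<longleftrightarrow> continuous_on S f"
| "Ck_on (Suc k) S f \<longleftrightarrow>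
     (\<forall>x\<in>S. f differentiable (at x)) \<and> (\<forall>v. Ck_on k S (\<lambda>x. frechet_derivative f (at x) v))"

definition smooth_on :: "'e::euclidean_space set \<Rightarrow> ('e \<Rightarrow> 'b::real_normed_vector) \<Rightarrow> bool" where
  "smooth_on S f \<longleftrightarrow> (\<forall>k. Ck_on k S f)"


section \<open>Smooth manifolds\<close>

type_synonym ('a, 'e) chart = "'a set \<times> ('a \<Rightarrow> 'e)"

record ('a, 'e) mfd =
  mtop :: "'a topology"
  atlas :: "('a, 'e) chart set"

text \<open>The model space is the Euclidean space \<^typ>\<open>'e\<close>, whose dimension is that of the manifold.  The atlas
  is not required to be maximal.\<close>

definition smooth_manifold :: "('a, 'e::euclidean_space) mfd \<Rightarrow> bool" where
  "smooth_manifold M \<longleftrightarrow>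
     Hausdorff_space (mtop M) \<and>
     (\<exists>\<B>. countable \<B> \<and> (\<forall>V\<in>\<B>. openin (mtop M) V) \<and>
        (\<forall>U p. openin (mtop M) U \<and> p \<in> U \<longrightarrow> (\<exists>V\<in>\<B>. p \<in> V \<and> V \<subseteq> U))) \<and>
     (\<Union>(fst ` atlas M)) = topspace (mtop M) \<and>
     (\<forall>(U, \<phi>)\<in>atlas M. openin (mtop M) U \<and> open (\<phi> ` U) \<and>
        homeomorphic_map (subtopology (mtop M) U) (top_of_set (\<phi> ` U)) \<phi>) \<and>
     (\<forall>(U, \<phi>)\<in>atlas M. \<forall>(V, \<psi>)\<in>atlas M.
        smooth_on (\<phi> ` (U \<inter> V)) (\<psi> \<circ> inv_into U \<phi>))"

definition smooth_fun :: "('a, 'e::euclidean_space) mfd \<Rightarrow> 'a set \<Rightarrow> ('a \<Rightarrow> real) \<Rightarrow> bool" where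
  "smooth_fun M U f \<longleftrightarrow> (\<forall>(V, \<phi>)\<in>atlas M. smooth_on (\<phi> ` (U \<inter> V)) (f \<circ> inv_into V \<phi>))"

definition smooth_near :: "('a, 'e::euclidean_space) mfd \<Rightarrow> 'a \<Rightarrow> ('a \<Rightarrow> real) \<Rightarrow> bool" where
  "smooth_near M p f \<longleftrightarrow> (\<exists>U. openin (mtop M) U \<and> p \<in> U \<and> smooth_fun M U f)"


section \<open>Tangent vectors and vector fields\<close>

text \<open>A tangent vector at \<^term>\<open>p\<close> is a directional derivative operator on germs of smooth functions at
  \<^term>\<open>p\<close>, represented as a functional on all functions which vanishes on those that are not smooth
  near \<^term>\<open>p\<close>.\<close>

type_synonym 'a tvec = "('a \<Rightarrow> real) \<Rightarrow> real"

type_synonym 'a field = "'a \<Rightarrow> 'a tvec"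

definition tscale :: "real \<Rightarrow> 'a tvec \<Rightarrow> 'a tvec" (infixr "*\<^sub>t" 75) where
  "r *\<^sub>t v = (\<lambda>f. r * v f)"

definition dir_deriv ::
    "('a, 'e::euclidean_space) mfd \<Rightarrow> ('a, 'e) chart \<Rightarrow> 'a \<Rightarrow> 'e \<Rightarrow> 'a tvec" where
  "dir_deriv M c p h = (\<lambda>f. if smooth_near M p f
     then frechet_derivative (f \<circ> inv_into (fst c) (snd c)) (at (snd c p)) h else 0)"

definition tangent_space :: "('a, 'e::euclidean_space) mfd \<Rightarrow> 'a \<Rightarrow> 'a tvec set" where
  "tangent_space M p = {dir_deriv M c p h | c h. c \<in> atlas M \<and> p \<in> fst c}"

text \<open>Vector fields are total functions; only their values on the open set \<^term>\<open>U\<close> on which they are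
  declared to be smooth vector fields matter.\<close>

definition vector_field_on :: "('a, 'e::euclidean_space) mfd \<Rightarrow> 'a set \<Rightarrow> 'a field \<Rightarrow> bool" where
  "vector_field_on M U X \<longleftrightarrow> openin (mtop M) U \<and> (\<forall>p\<in>U. X p \<in> tangent_space M p) \<and>
     (\<forall>V f. openin (mtop M) V \<and> V \<subseteq> U \<and> smooth_fun M V f \<longrightarrow> smooth_fun M V (\<lambda>p. X p f))"

text \<open>The test on \<^term>\<open>f\<close> keeps the values of the bracket inside the tangent spaces, which contain only
  functionals vanishing on non-smooth germs.\<close>

definition lie_bracket :: "('a, 'e::euclidean_space) mfd \<Rightarrow> 'a field \<Rightarrow> 'a field \<Rightarrow> 'a field" where
  "lie_bracket M X Y = (\<lambda>p f. if smooth_near M p f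
     then X p (\<lambda>q. Y q f) - Y p (\<lambda>q. X q f) else 0)"


section \<open>Tensor fields\<close>

definition one_form :: "('a, 'e::euclidean_space) mfd \<Rightarrow> ('a \<Rightarrow> 'a tvec \<Rightarrow> real) \<Rightarrow> bool" where
  "one_form M \<pi> \<longleftrightarrow>
     (\<forall>p\<in>topspace (mtop M). \<forall>u\<in>tangent_space M p. \<forall>v\<in>tangent_space M p. \<forall>r s.
        \<pi> p (r *\<^sub>t u + s *\<^sub>t v) = r * \<pi> p u + s * \<pi> p v) \<and>
     (\<forall>U X. vector_field_on M U X \<longrightarrow> smooth_fun M U (\<lambda>p. \<pi> p (X p)))"

definition endomorphism_field ::
    "('a, 'e::euclidean_space) mfd \<Rightarrow> ('a \<Rightarrow> 'a tvec \<Rightarrow> 'a tvec) \<Rightarrow> bool" where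
  "endomorphism_field M A \<longleftrightarrow>
     (\<forall>p\<in>topspace (mtop M). \<forall>u\<in>tangent_space M p. A p u \<in> tangent_space M p) \<and>
     (\<forall>p\<in>topspace (mtop M). \<forall>u\<in>tangent_space M p. \<forall>v\<in>tangent_space M p. \<forall>r s.
        A p (r *\<^sub>t u + s *\<^sub>t v) = r *\<^sub>t A p u + s *\<^sub>t A p v) \<and>
     (\<forall>U X. vector_field_on M U X \<longrightarrow> vector_field_on M U (\<lambda>p. A p (X p)))"

definition riemannian_metric ::
    "('a, 'e::euclidean_space) mfd \<Rightarrow> ('a \<Rightarrow> 'a tvec \<Rightarrow> 'a tvec \<Rightarrow> real) \<Rightarrow> bool" where
  "riemannian_metric M g \<longleftrightarrow>
     (\<forall>p\<in>topspace (mtop M). \<forall>u\<in>tangent_space M p. \<forall>v\<in>tangent_space M p. g p u v = g p v u) \<and>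
     (\<forall>p\<in>topspace (mtop M). \<forall>u\<in>tangent_space M p. \<forall>v\<in>tangent_space M p. \<forall>w\<in>tangent_space M p.
        \<forall>r s. g p (r *\<^sub>t u + s *\<^sub>t v) w = r * g p u w + s * g p v w) \<and>
     (\<forall>p\<in>topspace (mtop M). \<forall>u\<in>tangent_space M p. u \<noteq> 0 \<longrightarrow> 0 < g p u u) \<and>
     (\<forall>U X Y. vector_field_on M U X \<and> vector_field_on M U Y \<longrightarrow>
        smooth_fun M U (\<lambda>p. g p (X p) (Y p)))"


section \<open>Connections\<close>

text \<open>A connection assigns to smooth vector fields on a common open domain a smooth vector field on
  that domain, compatibly with restriction.  Because fields are total functions, the restriction
  property reads: on \<^term>\<open>U\<close>, the result depends only on the arguments on \<^term>\<open>U\<close>.\<close>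

definition affine_connection ::
    "('a, 'e::euclidean_space) mfd \<Rightarrow> ('a field \<Rightarrow> 'a field \<Rightarrow> 'a field) \<Rightarrow> bool" where
  "affine_connection M D \<longleftrightarrow>
     (\<forall>U X Y. vector_field_on M U X \<and> vector_field_on M U Y \<longrightarrow> vector_field_on M U (D X Y)) \<and>
     (\<forall>U X X' Y Y'. vector_field_on M U X \<and> vector_field_on M U X' \<and>
        vector_field_on M U Y \<and> vector_field_on M U Y' \<and>
        (\<forall>p\<in>U. X p = X' p \<and> Y p = Y' p) \<longrightarrow> (\<forall>p\<in>U. D X Y p = D X' Y' p)) \<and>
     (\<forall>U X X' Y. vector_field_on M U X \<and> vector_field_on M U X' \<and> vector_field_on M U Y \<longrightarrow>
        (\<forall>p\<in>U. D (\<lambda>q. X q + X' q) Y p = D X Y p + D X' Y p)) \<and>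
     (\<forall>U f X Y. smooth_fun M U f \<and> vector_field_on M U X \<and> vector_field_on M U Y \<longrightarrow>
        (\<forall>p\<in>U. D (\<lambda>q. f q *\<^sub>t X q) Y p = f p *\<^sub>t D X Y p)) \<and>
     (\<forall>U X Y Y'. vector_field_on M U X \<and> vector_field_on M U Y \<and> vector_field_on M U Y' \<longrightarrow>
        (\<forall>p\<in>U. D X (\<lambda>q. Y q + Y' q) p = D X Y p + D X Y' p)) \<and>
     (\<forall>U f X Y. smooth_fun M U f \<and> vector_field_on M U X \<and> vector_field_on M U Y \<longrightarrow>
        (\<forall>p\<in>U. D X (\<lambda>q. f q *\<^sub>t Y q) p = X p f *\<^sub>t Y p + f p *\<^sub>t D X Y p))"

definition levi_civita_connection ::
    "('a, 'e::euclidean_space) mfd \<Rightarrow> ('a \<Rightarrow> 'a tvec \<Rightarrow> 'a tvec \<Rightarrow> real) \<Rightarrow>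
     ('a field \<Rightarrow> 'a field \<Rightarrow> 'a field) \<Rightarrow> bool" where
  "levi_civita_connection M g D \<longleftrightarrow> affine_connection M D \<and>
     (\<forall>U X Y. vector_field_on M U X \<and> vector_field_on M U Y \<longrightarrow>
        (\<forall>p\<in>U. D X Y p - D Y X p = lie_bracket M X Y p)) \<and>
     (\<forall>U X Y Z. vector_field_on M U X \<and> vector_field_on M U Y \<and> vector_field_on M U Z \<longrightarrow>
        (\<forall>p\<in>U. X p (\<lambda>q. g q (Y q) (Z q)) = g p (D X Y p) (Z p) + g p (Y p) (D X Z p)))"

text \<open>The Levi-Civita connection \<^term>\<open>D\<close> is carried along as a parameter; the metric determines its
  values on smooth vector fields.\<close>

definition kaehler_manifold ::
    "('a, 'e::euclidean_space) mfd \<Rightarrow> ('a \<Rightarrow> 'a tvec \<Rightarrow> 'a tvec \<Rightarrow> real) \<Rightarrow>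
     ('a \<Rightarrow> 'a tvec \<Rightarrow> 'a tvec) \<Rightarrow> ('a field \<Rightarrow> 'a field \<Rightarrow> 'a field) \<Rightarrow> bool" where
  "kaehler_manifold M g A D \<longleftrightarrow>
     smooth_manifold M \<and> even DIM('e) \<and> 4 \<le> DIM('e) \<and>
     riemannian_metric M g \<and> endomorphism_field M A \<and> levi_civita_connection M g D \<and>
     (\<forall>p\<in>topspace (mtop M). \<forall>u\<in>tangent_space M p. A p (A p u) = - u) \<and>
     (\<forall>p\<in>topspace (mtop M). \<forall>u\<in>tangent_space M p. \<forall>v\<in>tangent_space M p.
        g p (A p u) (A p v) = g p u v) \<and>
     (\<forall>U X Y. vector_field_on M U X \<and> vector_field_on M U Y \<longrightarrow>
        (\<forall>p\<in>U. D X (\<lambda>q. A q (Y q)) p - A p (D X Y p) = 0))"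

definition quarter_symmetric_connection ::
    "('a, 'e::euclidean_space) mfd \<Rightarrow> ('a \<Rightarrow> 'a tvec \<Rightarrow> 'a tvec) \<Rightarrow>
     ('a field \<Rightarrow> 'a field \<Rightarrow> 'a field) \<Rightarrow> ('a \<Rightarrow> 'a tvec \<Rightarrow> real) \<Rightarrow>
     ('a field \<Rightarrow> 'a field \<Rightarrow> 'a field) \<Rightarrow> bool" where
  "quarter_symmetric_connection M A D \<pi> D1 \<longleftrightarrow>
     (\<forall>U X Y. vector_field_on M U X \<and> vector_field_on M U Y \<longrightarrow>
        (\<forall>p\<in>U. D1 X Y p = D X Y p - \<pi> p (X p) *\<^sub>t A p (Y p)))"


section \<open>Curvature\<close>

definition curvature ::
    "('a, 'e::euclidean_space) mfd \<Rightarrow> ('a field \<Rightarrow> 'a field \<Rightarrow> 'a field) \<Rightarrow>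
     'a field \<Rightarrow> 'a field \<Rightarrow> 'a field \<Rightarrow> 'a field" where
  "curvature M D X Y Z = (\<lambda>p. D X (D Y Z) p - D Y (D X Z) p - D (lie_bracket M X Y) Z p)"

definition cov_deriv_form ::
    "('a field \<Rightarrow> 'a field \<Rightarrow> 'a field) \<Rightarrow> ('a \<Rightarrow> 'a tvec \<Rightarrow> real) \<Rightarrow>
     'a field \<Rightarrow> 'a field \<Rightarrow> 'a \<Rightarrow> real" where
  "cov_deriv_form D \<pi> X Y p = X p (\<lambda>q. \<pi> q (Y q)) - \<pi> p (D X Y p)"

definition D2 ::
    "('a field \<Rightarrow> 'a field \<Rightarrow> 'a field) \<Rightarrow> ('a \<Rightarrow> 'a tvec \<Rightarrow> 'a tvec) \<Rightarrow>
     ('a \<Rightarrow> 'a tvec \<Rightarrow> real) \<Rightarrow> 'a field \<Rightarrow> 'a field \<Rightarrow> 'a \<Rightarrow> real" where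
  "D2 D A \<pi> X Y p = cov_deriv_form D \<pi> X Y p + \<pi> p (Y p) * \<pi> p (A p (X p))"

definition D3 ::
    "('a field \<Rightarrow> 'a field \<Rightarrow> 'a field) \<Rightarrow> ('a \<Rightarrow> 'a tvec \<Rightarrow> 'a tvec) \<Rightarrow>
     ('a \<Rightarrow> 'a tvec \<Rightarrow> real) \<Rightarrow> 'a field \<Rightarrow> 'a field \<Rightarrow> 'a \<Rightarrow> real" where
  "D3 D A \<pi> X Y p = cov_deriv_form D \<pi> X Y p + \<pi> p (X p) * \<pi> p (A p (Y p))"

definition curvature3 ::
    "('a, 'e::euclidean_space) mfd \<Rightarrow> ('a field \<Rightarrow> 'a field \<Rightarrow> 'a field) \<Rightarrow>
     ('a \<Rightarrow> 'a tvec \<Rightarrow> 'a tvec) \<Rightarrow> ('a \<Rightarrow> 'a tvec \<Rightarrow> real) \<Rightarrow>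
     'a field \<Rightarrow> 'a field \<Rightarrow> 'a field \<Rightarrow> 'a field" where
  "curvature3 M D A \<pi> X Y Z = (\<lambda>p. curvature M D X Y Z p
     - D2 D A \<pi> X Y p *\<^sub>t A p (Z p) + D3 D A \<pi> Y Z p *\<^sub>t A p (X p))"

text \<open>If \<^term>\<open>L\<close> is linear over smooth functions then \<^term>\<open>L X p\<close> depends only on \<^term>\<open>X p\<close>, so \<^term>\<open>L\<close> induces
  an endomorphism of the tangent space at \<^term>\<open>p\<close>.  Its trace is computed in the basis of coordinate
  vectors of a chart around \<^term>\<open>p\<close>: the component of a tangent vector \<^term>\<open>v\<close> along a coordinate vector is
  \<^term>\<open>v\<close> applied to the corresponding coordinate function.  For such \<^term>\<open>L\<close> the result does not depend
  on the chart.\<close>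

definition chart_at :: "('a, 'e::euclidean_space) mfd \<Rightarrow> 'a \<Rightarrow> ('a, 'e) chart" where
  "chart_at M p = (SOME c. c \<in> atlas M \<and> p \<in> fst c)"

definition coord_field ::
    "('a, 'e::euclidean_space) mfd \<Rightarrow> ('a, 'e) chart \<Rightarrow> 'e \<Rightarrow> 'a field" where
  "coord_field M c b = (\<lambda>q. dir_deriv M c q b)"

definition trace_at ::
    "('a, 'e::euclidean_space) mfd \<Rightarrow> 'a \<Rightarrow> ('a field \<Rightarrow> 'a field) \<Rightarrow> real" where
  "trace_at M p L = (let c = chart_at M p in
     \<Sum>b\<in>Basis. L (coord_field M c b) p (\<lambda>q. snd c q \<bullet> b))"

definition ricci3 ::
    "('a, 'e::euclidean_space) mfd \<Rightarrow> ('a field \<Rightarrow> 'a field \<Rightarrow> 'a field) \<Rightarrow>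
     ('a \<Rightarrow> 'a tvec \<Rightarrow> 'a tvec) \<Rightarrow> ('a \<Rightarrow> 'a tvec \<Rightarrow> real) \<Rightarrow>
     'a field \<Rightarrow> 'a field \<Rightarrow> 'a \<Rightarrow> real" where
  "ricci3 M D A \<pi> Y Z p = trace_at M p (\<lambda>X. curvature3 M D A \<pi> X Y Z)"

text \<open>The trace over the last argument, written with a prime in front of the curvature symbol.\<close>

definition prime_curvature3 ::
    "('a, 'e::euclidean_space) mfd \<Rightarrow> ('a field \<Rightarrow> 'a field \<Rightarrow> 'a field) \<Rightarrow>
     ('a \<Rightarrow> 'a tvec \<Rightarrow> 'a tvec) \<Rightarrow> ('a \<Rightarrow> 'a tvec \<Rightarrow> real) \<Rightarrow>
     'a field \<Rightarrow> 'a field \<Rightarrow> 'a \<Rightarrow> real" where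
  "prime_curvature3 M D A \<pi> X Y p = trace_at M p (\<lambda>Z. curvature3 M D A \<pi> X Y Z)"

definition H3 ::
    "('a, 'e::euclidean_space) mfd \<Rightarrow> ('a field \<Rightarrow> 'a field \<Rightarrow> 'a field) \<Rightarrow>
     ('a \<Rightarrow> 'a tvec \<Rightarrow> 'a tvec) \<Rightarrow> ('a \<Rightarrow> 'a tvec \<Rightarrow> real) \<Rightarrow>
     'a field \<Rightarrow> 'a field \<Rightarrow> 'a field \<Rightarrow> 'a field" where
  "H3 M D A \<pi> X Y Z = (\<lambda>p. curvature3 M D A \<pi> X Y Z p
     + ricci3 M D A \<pi> Y (\<lambda>q. A q (X q)) p *\<^sub>t A p (Z p)
     + prime_curvature3 M D A \<pi> (\<lambda>q. A q (Z q)) Y p *\<^sub>t A p (X p))"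

end

theory Submission
  imports Defs
begin

text \<open>Since \<open>A\<close> is skew-adjoint, its trace vanishes, and \<open>A\<^sup>2 = -I\<close>.  Hence, writing \<open>Ric\<close> and \<open>'R\<close> for the
  two traces of the Riemannian curvature, the generator enters the traces of the curvature tensor of
  the third kind only through \<open>Ric3(Y, AX) = Ric(Y, AX) + D2(X, Y)\<close> and
  \<open>'R3(AZ, Y) = 'R(AZ, Y) - D3(Y, Z)\<close>, and these contributions to \<open>H3\<close> cancel the terms
  \<open>- D2(X, Y) AZ + D3(Y, Z) AX\<close> of \<open>R3(X, Y)Z\<close>.  Evaluating the traces requires that \<open>D2\<close> is tensorial in
  its first and \<open>D3\<close> in its second argument.\<close>

section \<open>Calculus of smooth maps\<close>

lemma Ck_on_mono: "Ck_on k S f \<Longrightarrow> T \<subseteq> S \<Longrightarrow> Ck_on k T f"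
  by (induction k arbitrary: f) (auto intro: continuous_on_subset)

lemma smooth_on_mono: "smooth_on S f \<Longrightarrow> T \<subseteq> S \<Longrightarrow> smooth_on T f"
  unfolding smooth_on_def by (blast intro: Ck_on_mono)

text \<open>A derivative at an interior point depends only on the germ of the function. Identities
  involving \<open>inv_into\<close> of a chart hold only on the chart image, so they can be
  differentiated only in this form.\<close>

lemma has_derivative_cong_on_open:
  assumes "open S" "x \<in> S" "\<And>y. y \<in> S \<Longrightarrow> f y = g y"
  shows "(f has_derivative f') (at x) \<longleftrightarrow> (g has_derivative f') (at x)"
proof
  assume "(f has_derivative f') (at x)"
  then show "(g has_derivative f') (at x)"
    by (rule has_derivative_transform_within_open[OF _ assms])
next
  assume "(g has_derivative f') (at x)"
  then show "(f has_derivative f') (at x)"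
    by (rule has_derivative_transform_within_open[OF _ assms(1,2)]) (simp add: assms(3))
qed

lemma differentiable_cong_on_open:
  assumes "open S" "x \<in> S" "\<And>y. y \<in> S \<Longrightarrow> f y = g y"
  shows "f differentiable (at x) \<longleftrightarrow> g differentiable (at x)"
proof -
  have "(f has_derivative D) (at x) \<longleftrightarrow> (g has_derivative D) (at x)" for D
    by (rule has_derivative_cong_on_open[OF assms])
  then show ?thesis by (simp add: differentiable_def)
qed

lemma frechet_derivative_cong_on_open:
  assumes "open S" "x \<in> S" "\<And>y. y \<in> S \<Longrightarrow> f y = g y"
  shows "frechet_derivative f (at x) = frechet_derivative g (at x)"
proof -
  \<comment> \<open>As the equivalence holds for every candidate \<open>D\<close>, the choice
    operator in \<open>frechet_derivative\<close> selects the same map on both sides, whether or not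
    a derivative exists.\<close>
  have "(f has_derivative D) (at x) \<longleftrightarrow> (g has_derivative D) (at x)" for D
    by (rule has_derivative_cong_on_open[OF assms])
  then show ?thesis by (simp add: frechet_derivative_def)
qed

text \<open>Openness of \<open>S\<close> lets agreement on \<open>S\<close> pass to the derivatives,
  which \<open>Ck_on\<close> takes in the full space. The induction varies \<open>f\<close> and
  \<open>g\<close> so that they can be replaced by their directional derivatives.\<close>

lemma Ck_on_cong:
  assumes "open S" "\<And>x. x \<in> S \<Longrightarrow> f x = g x"
  shows "Ck_on k S f \<longleftrightarrow> Ck_on k S g"
  using assms(2)
proof (induction k arbitrary: f g)
  case 0
  then show ?case by (simp cong: continuous_on_cong)
next
  case (Suc k)
  have d: "f differentiable (at x) \<longleftrightarrow> g differentiable (at x)"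
    "frechet_derivative f (at x) = frechet_derivative g (at x)" if "x \<in> S" for x
    by (rule differentiable_cong_on_open[OF assms(1) that Suc.prems], assumption)
      (rule frechet_derivative_cong_on_open[OF assms(1) that Suc.prems])
  have "Ck_on k S (\<lambda>x. frechet_derivative f (at x) v) \<longleftrightarrow>
      Ck_on k S (\<lambda>x. frechet_derivative g (at x) v)" for v
    by (rule Suc.IH) (simp add: d(2))
  then show ?case by (simp add: d(1))
qed

lemma smooth_on_cong:
  "open S \<Longrightarrow> (\<And>x. x \<in> S \<Longrightarrow> f x = g x) \<Longrightarrow> smooth_on S f \<longleftrightarrow> smooth_on S g"
  unfolding smooth_on_def by (subst Ck_on_cong) auto

lemma Ck_on_SucD: "Ck_on (Suc k) S f \<Longrightarrow> Ck_on k S f"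
proof (induction k arbitrary: f)
  case 0
  then show ?case
    by (auto intro!: continuous_at_imp_continuous_on differentiable_imp_continuous_within)
next
  case (Suc k)
  then show ?case by simp
qed

lemma smooth_on_imp_differentiable: "smooth_on S f \<Longrightarrow> x \<in> S \<Longrightarrow> f differentiable (at x)"
  unfolding smooth_on_def by (drule spec[of _ "Suc 0"]) simp

lemma smooth_on_frechet_derivative:
  "smooth_on S f \<Longrightarrow> smooth_on S (\<lambda>x. frechet_derivative f (at x) v)"
  unfolding smooth_on_def
proof
  fix k
  assume "\<forall>k. Ck_on k S f"
  then have "Ck_on (Suc k) S f" ..
  then show "Ck_on k S (\<lambda>x. frechet_derivative f (at x) v)" by simp
qed

section \<open>Closure of differentiability classes under linear maps, sums, products and
  composition\<close>

lemma Ck_on_const: "Ck_on k S (\<lambda>_. c)"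
proof (induction k arbitrary: c)
  case (Suc k)
  then show ?case by (auto simp: frechet_derivative_const)
qed simp

lemma frechet_derivative_bounded_linear:
  assumes "f differentiable (at x)" "bounded_linear L"
  shows "frechet_derivative (\<lambda>x. L (f x)) (at x) v = L (frechet_derivative f (at x) v)"
  by (simp add: frechet_derivative_at[OF bounded_linear.has_derivative[OF assms(2)
        assms(1)[unfolded frechet_derivative_works]], symmetric])

lemma Ck_on_bounded_linear:
  assumes "open S" "bounded_linear L" "Ck_on k S f"
  shows "Ck_on k S (\<lambda>x. L (f x))"
  using assms(3)
proof (induction k arbitrary: f)
  case 0
  then show ?case using assms(2) by (auto intro: bounded_linear.continuous_on)
next
  case (Suc k)
  have d: "f differentiable (at x)" if "x \<in> S" for x using Suc.prems that by simp
  have "Ck_on k S (\<lambda>x. L (frechet_derivative f (at x) v))" for v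
    using Suc by simp
  then have "Ck_on k S (\<lambda>x. frechet_derivative (\<lambda>x. L (f x)) (at x) v)" for v
    using d by (subst Ck_on_cong[OF assms(1)]) (auto simp: frechet_derivative_bounded_linear assms(2))
  moreover have "(\<lambda>x. L (f x)) differentiable (at x)" if "x \<in> S" for x
    using differentiable_compose[OF bounded_linear_imp_differentiable[OF assms(2)] d[OF that]]
    by (simp add: o_def)
  ultimately show ?case by simp
qed

lemma frechet_derivative_add:
  assumes "f differentiable (at x)" "g differentiable (at x)"
  shows "frechet_derivative (\<lambda>x. f x + g x) (at x) v
    = frechet_derivative f (at x) v + frechet_derivative g (at x) v"
  by (simp add: frechet_derivative_at[OF has_derivative_add[OF
        assms[unfolded frechet_derivative_works]], symmetric])

lemma Ck_on_add:
  assumes "open S" "Ck_on k S f" "Ck_on k S g"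
  shows "Ck_on k S (\<lambda>x. f x + g x)"
  using assms(2,3)
proof (induction k arbitrary: f g)
  case 0
  then show ?case by (auto intro: continuous_on_add)
next
  case (Suc k)
  have d: "f differentiable (at x)" "g differentiable (at x)" if "x \<in> S" for x
    using Suc.prems that by auto
  have "Ck_on k S (\<lambda>x. frechet_derivative f (at x) v + frechet_derivative g (at x) v)" for v
    using Suc by simp
  then have "Ck_on k S (\<lambda>x. frechet_derivative (\<lambda>x. f x + g x) (at x) v)" for v
    using d by (subst Ck_on_cong[OF assms(1)]) (auto simp: frechet_derivative_add)
  then show ?case using d by simp
qed

lemma frechet_derivative_mult:
  fixes f g :: "'e::real_normed_vector \<Rightarrow> real"
  assumes "f differentiable (at x)" "g differentiable (at x)"
  shows "frechet_derivative (\<lambda>x. f x * g x) (at x) v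
    = f x * frechet_derivative g (at x) v + frechet_derivative f (at x) v * g x"
  by (simp add: frechet_derivative_at[OF has_derivative_mult[OF
        assms[unfolded frechet_derivative_works]], symmetric])

lemma Ck_on_mult:
  fixes f g :: "'e::euclidean_space \<Rightarrow> real"
  assumes "open S" "Ck_on k S f" "Ck_on k S g"
  shows "Ck_on k S (\<lambda>x. f x * g x)"
  using assms(2,3)
proof (induction k arbitrary: f g)
  case 0
  then show ?case by (auto intro: continuous_on_mult)
next
  case (Suc k)
  have d: "f differentiable (at x)" "g differentiable (at x)" if "x \<in> S" for x
    using Suc.prems that by auto
  \<comment> \<open>The product rule mixes derivatives, known at level \<open>k\<close>, with
    undifferentiated factors, known at level \<open>Suc k\<close>; \<open>Ck_on_SucD\<close> lowers
    the latter.\<close>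
  have "Ck_on k S (\<lambda>x. f x * frechet_derivative g (at x) v + frechet_derivative f (at x) v * g x)" for v
    using Suc.prems by (intro Ck_on_add Suc.IH assms(1))
      (auto intro: Ck_on_SucD[OF Suc.prems(1)] Ck_on_SucD[OF Suc.prems(2)])
  then have "Ck_on k S (\<lambda>x. frechet_derivative (\<lambda>x. f x * g x) (at x) v)" for v
    using d by (subst Ck_on_cong[OF assms(1)]) (auto simp: frechet_derivative_mult)
  then show ?case using d by simp
qed

lemma Ck_on_sum:
  assumes "open S" "finite I" "\<And>i. i \<in> I \<Longrightarrow> Ck_on k S (f i)"
  shows "Ck_on k S (\<lambda>x. \<Sum>i\<in>I. f i x)"
  using assms(2,3) by (induction I) (auto intro!: Ck_on_add assms(1) Ck_on_const)

lemma linear_Basis_expansion: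
  fixes L :: "'e::euclidean_space \<Rightarrow> 'b::real_vector"
  assumes "linear L"
  shows "L h = (\<Sum>b\<in>Basis. (h \<bullet> b) *\<^sub>R L b)"
proof -
  have "L h = L (\<Sum>b\<in>Basis. (h \<bullet> b) *\<^sub>R b)"
    by (simp only: euclidean_representation)
  also have "\<dots> = (\<Sum>b\<in>Basis. (h \<bullet> b) *\<^sub>R L b)"
    by (simp only: linear_sum[OF assms] linear_scale[OF assms])
  finally show ?thesis .
qed

lemma frechet_derivative_chain:
  assumes "f differentiable (at x)" "g differentiable (at (f x))"
  shows "frechet_derivative (\<lambda>x. g (f x)) (at x) v =
    frechet_derivative g (at (f x)) (frechet_derivative f (at x) v)"
  using frechet_derivative_compose[OF assms] by (simp add: o_def)

text \<open>In the chain rule the derivative of \<open>f\<close> is taken in a direction that varies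
  with \<open>x\<close>, whereas \<open>Ck_on\<close> speaks of fixed directions only. Expanding the
  direction in the basis reduces the derivative to sums of products of functions of class
  \<open>k\<close>.\<close>

lemma Ck_on_compose:
  fixes f :: "'e::euclidean_space \<Rightarrow> real" and T :: "'d::euclidean_space \<Rightarrow> 'e"
  assumes "open S" "T ` S \<subseteq> S'" "Ck_on k S T" "Ck_on k S' f"
  shows "Ck_on k S (\<lambda>x. f (T x))"
  using assms(3,4)
proof (induction k arbitrary: f)
  case 0
  then show ?case using assms(2) by (auto intro: continuous_on_compose2[of S' f])
next
  case (Suc k)
  have d: "T differentiable (at x)" "f differentiable (at (T x))" if "x \<in> S" for x
    using Suc.prems that assms(2) by auto
  have eq: "frechet_derivative (\<lambda>x. f (T x)) (at x) v =
      (\<Sum>b\<in>Basis. (frechet_derivative T (at x) v \<bullet> b) * frechet_derivative f (at (T x)) b)"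
    if "x \<in> S" for x v
    unfolding frechet_derivative_chain[OF d[OF that]]
    using linear_Basis_expansion[OF linear_frechet_derivative[OF d(2)[OF that]]]
    unfolding real_scaleR_def .
  have "Ck_on k S (\<lambda>x. \<Sum>b\<in>Basis.
      (frechet_derivative T (at x) v \<bullet> b) * frechet_derivative f (at (T x)) b)" for v
  proof (intro Ck_on_sum Ck_on_mult assms(1) finite_Basis)
    fix b :: 'e
    show "Ck_on k S (\<lambda>x. frechet_derivative T (at x) v \<bullet> b)"
      using Suc.prems by (intro Ck_on_bounded_linear[OF assms(1) bounded_linear_inner_left]) simp
    \<comment> \<open>The outer function becomes a partial derivative of \<open>f\<close> while
      \<open>T\<close> stays fixed, hence an induction over arbitrary \<open>f\<close>.\<close>
    show "Ck_on k S (\<lambda>x. frechet_derivative f (at (T x)) b)"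
      using Suc.prems(2) by (intro Suc.IH Ck_on_SucD[OF Suc.prems(1)]) simp
  qed
  then have "Ck_on k S (\<lambda>x. frechet_derivative (\<lambda>x. f (T x)) (at x) v)" for v
    by (subst Ck_on_cong[OF assms(1) eq])
  then show ?case using d by (simp add: differentiable_compose)
qed

section \<open>Passage to infinitely differentiable maps\<close>

lemma smooth_on_const: "smooth_on S (\<lambda>_. c)"
  by (simp add: smooth_on_def Ck_on_const)

lemma smooth_on_bounded_linear:
  "open S \<Longrightarrow> bounded_linear L \<Longrightarrow> smooth_on S f \<Longrightarrow> smooth_on S (\<lambda>x. L (f x))"
  by (simp add: smooth_on_def Ck_on_bounded_linear)

lemma smooth_on_add:
  "open S \<Longrightarrow> smooth_on S f \<Longrightarrow> smooth_on S g \<Longrightarrow> smooth_on S (\<lambda>x. f x + g x)"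
  by (simp add: smooth_on_def Ck_on_add)

lemma smooth_on_mult:
  fixes f g :: "'e::euclidean_space \<Rightarrow> real"
  shows "open S \<Longrightarrow> smooth_on S f \<Longrightarrow> smooth_on S g \<Longrightarrow> smooth_on S (\<lambda>x. f x * g x)"
  by (simp add: smooth_on_def Ck_on_mult)

lemma smooth_on_compose:
  fixes f :: "'e::euclidean_space \<Rightarrow> real"
  shows "open S \<Longrightarrow> T ` S \<subseteq> S' \<Longrightarrow> smooth_on S T \<Longrightarrow> smooth_on S' f
    \<Longrightarrow> smooth_on S (\<lambda>x. f (T x))"
  unfolding smooth_on_def by (blast intro: Ck_on_compose)

section \<open>The trace of a skew endomorphism\<close>

text \<open>Both sides are the same double sum of products of matrix entries, summed in opposite
  orders.\<close>

lemma trace_comp_commute: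
  fixes f g :: "'e::euclidean_space \<Rightarrow> 'e"
  assumes "linear f" "linear g"
  shows "(\<Sum>b\<in>Basis. f (g b) \<bullet> b) = (\<Sum>b\<in>Basis. g (f b) \<bullet> b)"
proof -
  have *: "(\<Sum>b\<in>Basis. f (g b) \<bullet> b) = (\<Sum>b\<in>Basis. \<Sum>c\<in>Basis. (g b \<bullet> c) * (f c \<bullet> b))"
    if "linear f" for f g :: "'e \<Rightarrow> 'e"
    by (subst linear_Basis_expansion[OF that]) (simp add: inner_sum_left)
  show ?thesis
    unfolding *[OF assms(1)] *[OF assms(2)]
    by (subst sum.swap) (simp add: mult.commute)
qed

text \<open>The trace is computed in the standard basis while skewness refers to \<open>G\<close>.
  With the Gram operator \<open>T\<close> of \<open>G\<close>, the trace of \<open>a\<close> equals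
  that of \<open>T a T^-1\<close>, and skewness turns the latter into minus the trace of
  \<open>a\<close>.\<close>

lemma trace_skew_eq_0:
  fixes a :: "'e::euclidean_space \<Rightarrow> 'e" and G :: "'e \<Rightarrow> 'e \<Rightarrow> real"
  assumes "linear a" "\<And>k. linear (\<lambda>h. G h k)" "\<And>h. linear (G h)"
    and pos: "\<And>h. h \<noteq> 0 \<Longrightarrow> 0 < G h h"
    and skew: "\<And>h k. G (a h) k = - G h (a k)"
  shows "(\<Sum>b\<in>Basis. a b \<bullet> b) = 0"
proof -
  \<comment> \<open>\<open>T\<close> is the Gram operator: it represents \<open>G\<close> through
    the standard inner product.\<close>
  define T where "T h = (\<Sum>b\<in>Basis. G h b *\<^sub>R b)" for h
  have T: "T h \<bullet> k = G h k" for h k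
    using linear_Basis_expansion[OF assms(3)[of h], of k]
    by (simp add: T_def inner_sum_left mult.commute) (simp add: inner_commute)
  have "linear T"
    by (rule linearI)
      (simp_all add: T_def linear_add[OF assms(2)] linear_scale[OF assms(2)] scaleR_left_distrib
        sum.distrib scaleR_sum_right)
  \<comment> \<open>A nonzero kernel vector would have \<open>G h h = 0\<close>. In finite dimension
    injectivity already provides the inverse \<open>S\<close>.\<close>
  moreover have "inj T"
    unfolding linear_injective_0[OF \<open>linear T\<close>] by (metis T inner_zero_left pos less_irrefl)
  ultimately obtain S where S: "linear S" "\<And>x. S (T x) = x" "\<And>x. T (S x) = x"
    using linear_injective_isomorphism by blast
  have "(\<Sum>b\<in>Basis. a b \<bullet> b) = (\<Sum>b\<in>Basis. S (T (a b)) \<bullet> b)"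
    by (simp add: S)
  also have "\<dots> = (\<Sum>b\<in>Basis. T (a (S b)) \<bullet> b)"
    using trace_comp_commute[OF S(1) linear_compose[OF assms(1) \<open>linear T\<close>]] by (simp add: o_def)
  \<comment> \<open>Skewness moves \<open>a\<close> to the second argument of \<open>G\<close>,
    after which \<open>T (S b) = b\<close> removes the conjugation.\<close>
  also have "\<dots> = - (\<Sum>b\<in>Basis. a b \<bullet> b)"
    by (simp add: T skew sum_negf) (simp add: T[symmetric] S inner_commute)
  finally show ?thesis by simp
qed


section \<open>Charts and smooth functions\<close>

abbreviation chart_inv :: "('a, 'e) chart \<Rightarrow> 'e \<Rightarrow> 'a" where
  "chart_inv c \<equiv> inv_into (fst c) (snd c)"

locale smooth_mfd =
  fixes M :: "('a, 'e::euclidean_space) mfd"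
  assumes smooth_manifold: "smooth_manifold M"
begin

section \<open>Charts as homeomorphisms onto open sets\<close>

lemma chart:
  assumes "c \<in> atlas M"
  shows openin_chart: "openin (mtop M) (fst c)"
    and open_chart_image: "open (snd c ` fst c)"
    and chart_homeomorphic:
      "homeomorphic_map (subtopology (mtop M) (fst c)) (top_of_set (snd c ` fst c)) (snd c)"
  using smooth_manifold assms unfolding smooth_manifold_def by (auto simp: case_prod_beta)

lemma transition_smooth:
  assumes "c \<in> atlas M" "c' \<in> atlas M"
  shows "smooth_on (snd c ` (fst c \<inter> fst c')) (snd c' \<circ> chart_inv c)"
  using smooth_manifold assms unfolding smooth_manifold_def by (auto simp: case_prod_beta)

lemma ex_chart:
  assumes "p \<in> topspace (mtop M)"
  shows "\<exists>c\<in>atlas M. p \<in> fst c"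
proof -
  have "p \<in> \<Union>(fst ` atlas M)"
    using smooth_manifold assms unfolding smooth_manifold_def by simp
  then show ?thesis by blast
qed

lemma chart_at:
  assumes "p \<in> topspace (mtop M)"
  shows "chart_at M p \<in> atlas M" "p \<in> fst (chart_at M p)"
  using someI_ex[of "\<lambda>c. c \<in> atlas M \<and> p \<in> fst c"] ex_chart[OF assms]
  unfolding chart_at_def by blast+

lemma inj_on_chart:
  assumes "c \<in> atlas M"
  shows "inj_on (snd c) (fst c)"
  using homeomorphic_imp_injective_map[OF chart_homeomorphic[OF assms]] openin_subset[OF openin_chart[OF assms]]
  by (simp add: topspace_subtopology Int_absorb1)

lemma chart_inv_chart [simp]: "c \<in> atlas M \<Longrightarrow> q \<in> fst c \<Longrightarrow> chart_inv c (snd c q) = q"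
  by (simp add: inj_on_chart)

text \<open>A chart is an open map onto its image, and relatively open sets are open because that
  image is. This supplies the openness that every local comparison of derivatives asks for.\<close>

lemma open_chart_image_Int:
  assumes "c \<in> atlas M" "openin (mtop M) W"
  shows "open (snd c ` (W \<inter> fst c))"
proof -
  have "openin (subtopology (mtop M) (fst c)) (W \<inter> fst c)"
    using assms(2) by (auto simp: openin_subtopology)
  then have "openin (top_of_set (snd c ` fst c)) (snd c ` (W \<inter> fst c))"
    using homeomorphic_imp_open_map[OF chart_homeomorphic[OF assms(1)]] unfolding open_map_def by blast
  then show ?thesis
    using openin_open_trans open_chart_image[OF assms(1)] by blast
qed

section \<open>Smooth functions on open subsets of the manifold\<close>

lemma smooth_funD:
  "smooth_fun M U f \<Longrightarrow> c \<in> atlas M \<Longrightarrow> smooth_on (snd c ` (U \<inter> fst c)) (f \<circ> chart_inv c)"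
  unfolding smooth_fun_def by (auto simp: case_prod_beta)

lemma smooth_funI:
  "(\<And>c. c \<in> atlas M \<Longrightarrow> smooth_on (snd c ` (U \<inter> fst c)) (f \<circ> chart_inv c)) \<Longrightarrow> smooth_fun M U f"
  unfolding smooth_fun_def by (simp add: case_prod_beta)

lemma smooth_fun_mono: "smooth_fun M U f \<Longrightarrow> W \<subseteq> U \<Longrightarrow> smooth_fun M W f"
  by (rule smooth_funI, rule smooth_on_mono[OF smooth_funD[of U]]) auto

lemma smooth_fun_cong:
  assumes "smooth_fun M U f" "openin (mtop M) U" "\<And>q. q \<in> U \<Longrightarrow> f q = g q"
  shows "smooth_fun M U g"
proof (rule smooth_funI)
  fix c assume c: "c \<in> atlas M"
  have "smooth_on (snd c ` (U \<inter> fst c)) (f \<circ> chart_inv c) \<longleftrightarrow>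
      smooth_on (snd c ` (U \<inter> fst c)) (g \<circ> chart_inv c)"
    by (rule smooth_on_cong[OF open_chart_image_Int[OF c assms(2)]]) (auto simp: c assms(3))
  then show "smooth_on (snd c ` (U \<inter> fst c)) (g \<circ> chart_inv c)"
    using smooth_funD[OF assms(1) c] by simp
qed

lemma smooth_fun_const: "smooth_fun M U (\<lambda>_. r)"
  by (intro smooth_funI) (simp add: o_def smooth_on_const)

lemma smooth_fun_add:
  assumes "openin (mtop M) U" "smooth_fun M U f" "smooth_fun M U g"
  shows "smooth_fun M U (\<lambda>q. f q + g q)"
  using smooth_on_add[OF open_chart_image_Int[OF _ assms(1)] smooth_funD[OF assms(2)] smooth_funD[OF assms(3)]]
  by (intro smooth_funI) (simp add: o_def)

lemma smooth_fun_mult: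
  assumes "openin (mtop M) U" "smooth_fun M U f" "smooth_fun M U g"
  shows "smooth_fun M U (\<lambda>q. f q * g q)"
  using smooth_on_mult[OF open_chart_image_Int[OF _ assms(1)] smooth_funD[OF assms(2)] smooth_funD[OF assms(3)]]
  by (intro smooth_funI) (simp add: o_def)

text \<open>Seen in another chart, a coordinate function is a component of a transition map.\<close>

lemma smooth_fun_coord:
  assumes "c \<in> atlas M"
  shows "smooth_fun M (fst c) (\<lambda>q. snd c q \<bullet> b)"
proof (rule smooth_funI)
  fix c' assume c': "c' \<in> atlas M"
  have "smooth_on (snd c' ` (fst c \<inter> fst c')) (\<lambda>x. (snd c \<circ> chart_inv c') x \<bullet> b)"
    using smooth_on_bounded_linear[OF open_chart_image_Int[OF c' openin_chart[OF assms]]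
        bounded_linear_inner_left] transition_smooth[OF c' assms]
    by (metis Int_commute)
  then show "smooth_on (snd c' ` (fst c \<inter> fst c')) ((\<lambda>q. snd c q \<bullet> b) \<circ> chart_inv c')"
    by (simp add: o_def)
qed

section \<open>Smooth germs at a point\<close>

lemma smooth_nearI: "smooth_fun M U f \<Longrightarrow> openin (mtop M) U \<Longrightarrow> p \<in> U \<Longrightarrow> smooth_near M p f"
  unfolding smooth_near_def by blast

lemma smooth_near_differentiable:
  assumes "smooth_near M p f" "c \<in> atlas M" "p \<in> fst c"
  shows "(f \<circ> chart_inv c) differentiable (at (snd c p))"
proof -
  obtain U where U: "p \<in> U" "smooth_fun M U f"
    using assms(1) unfolding smooth_near_def by blast
  show ?thesis
    by (rule smooth_on_imp_differentiable[OF smooth_funD[OF U(2) assms(2)]]) (use U assms in auto)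
qed

lemma smooth_near_cong:
  assumes "smooth_near M p f" "openin (mtop M) W" "p \<in> W" "\<And>q. q \<in> W \<Longrightarrow> f q = g q"
  shows "smooth_near M p g"
proof -
  obtain U where U: "openin (mtop M) U" "p \<in> U" "smooth_fun M U f"
    using assms(1) unfolding smooth_near_def by blast
  have "smooth_fun M (U \<inter> W) g"
    by (rule smooth_fun_cong[OF smooth_fun_mono[OF U(3)]]) (use U assms in auto)
  then show ?thesis
    by (rule smooth_nearI) (use U assms in auto)
qed

lemma smooth_near_add:
  assumes "smooth_near M p f" "smooth_near M p g"
  shows "smooth_near M p (\<lambda>q. f q + g q)"
proof -
  obtain U V where "openin (mtop M) U" "p \<in> U" "smooth_fun M U f"
      "openin (mtop M) V" "p \<in> V" "smooth_fun M V g"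
    using assms unfolding smooth_near_def by blast
  then show ?thesis
    by (intro smooth_nearI[of "U \<inter> V"] smooth_fun_add) (auto intro: smooth_fun_mono)
qed

lemma smooth_near_mult:
  assumes "smooth_near M p f" "smooth_near M p g"
  shows "smooth_near M p (\<lambda>q. f q * g q)"
proof -
  obtain U V where "openin (mtop M) U" "p \<in> U" "smooth_fun M U f"
      "openin (mtop M) V" "p \<in> V" "smooth_fun M V g"
    using assms unfolding smooth_near_def by blast
  then show ?thesis
    by (intro smooth_nearI[of "U \<inter> V"] smooth_fun_mult) (auto intro: smooth_fun_mono)
qed

lemma smooth_near_coord:
  "c \<in> atlas M \<Longrightarrow> p \<in> fst c \<Longrightarrow> smooth_near M p (\<lambda>q. snd c q \<bullet> b)"
  by (blast intro: smooth_nearI smooth_fun_coord openin_chart)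


section \<open>Tangent vectors\<close>

text \<open>On smooth germs this is linearity of the derivative; on all others every
  \<open>dir_deriv\<close> is 0, so the identity holds between total functionals.\<close>

lemma dir_deriv_add:
  assumes "c \<in> atlas M" "p \<in> fst c"
  shows "dir_deriv M c p (h + k) = dir_deriv M c p h + dir_deriv M c p k"
proof
  fix f
  show "dir_deriv M c p (h + k) f = (dir_deriv M c p h + dir_deriv M c p k) f"
    using linear_add[OF linear_frechet_derivative[OF smooth_near_differentiable[OF _ assms]]]
    by (simp add: dir_deriv_def)
qed

lemma dir_deriv_scaleR:
  assumes "c \<in> atlas M" "p \<in> fst c"
  shows "dir_deriv M c p (r *\<^sub>R h) = r *\<^sub>t dir_deriv M c p h"
proof
  fix f
  show "dir_deriv M c p (r *\<^sub>R h) f = (r *\<^sub>t dir_deriv M c p h) f"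
    using linear_scale[OF linear_frechet_derivative[OF smooth_near_differentiable[OF _ assms]]]
    by (simp add: dir_deriv_def tscale_def)
qed

text \<open>By the chain rule, directions transform under the derivative of the transition
  map.\<close>

lemma dir_deriv_change_chart:
  assumes "c \<in> atlas M" "p \<in> fst c" "c' \<in> atlas M" "p \<in> fst c'"
  shows "dir_deriv M c p h =
    dir_deriv M c' p (frechet_derivative (snd c' \<circ> chart_inv c) (at (snd c p)) h)"
proof
  fix f
  let ?S = "snd c ` (fst c' \<inter> fst c)" and ?T = "snd c' \<circ> chart_inv c"
  have "frechet_derivative (f \<circ> chart_inv c) (at (snd c p)) h =
      frechet_derivative (f \<circ> chart_inv c') (at (snd c' p)) (frechet_derivative ?T (at (snd c p)) h)"
    if f: "smooth_near M p f"
  proof -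
    \<comment> \<open>The factorisation through the second chart is available on the image of the
      overlap, an open set around the point.\<close>
    have "frechet_derivative (f \<circ> chart_inv c) (at (snd c p)) h =
        frechet_derivative (\<lambda>x. (f \<circ> chart_inv c') (?T x)) (at (snd c p)) h"
      by (rule fun_cong[OF frechet_derivative_cong_on_open[OF
            open_chart_image_Int[OF assms(1) openin_chart[OF assms(3)]]]]) (use assms in auto)
    also have "\<dots> = frechet_derivative (f \<circ> chart_inv c') (at (?T (snd c p)))
        (frechet_derivative ?T (at (snd c p)) h)"
    proof (rule frechet_derivative_chain)
      show "?T differentiable (at (snd c p))"
        by (rule smooth_on_imp_differentiable[OF transition_smooth[OF assms(1,3)]]) (use assms in auto)
      show "(f \<circ> chart_inv c') differentiable (at (?T (snd c p)))"
        using smooth_near_differentiable[OF f assms(3,4)] assms by simp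
    qed
    finally show ?thesis using assms by simp
  qed
  then show "dir_deriv M c p h f = dir_deriv M c' p (frechet_derivative ?T (at (snd c p)) h) f"
    by (simp add: dir_deriv_def)
qed

text \<open>A change of chart rewrites every tangent vector as a directional derivative in the given
  chart, so linear algebra at \<open>p\<close> can be done in one chart.\<close>

lemma tangent_space_chart:
  assumes "c \<in> atlas M" "p \<in> fst c"
  shows "tangent_space M p = range (dir_deriv M c p)"
  unfolding tangent_space_def using assms dir_deriv_change_chart[OF _ _ assms] by blast

lemma tangent_vector_add:
  assumes "u \<in> tangent_space M p" "v \<in> tangent_space M p"
  shows "u + v \<in> tangent_space M p"
proof -
  obtain c where "c \<in> atlas M" "p \<in> fst c"
    using assms unfolding tangent_space_def by blast
  then show ?thesis using assms
    by (auto simp: tangent_space_chart dir_deriv_add[symmetric])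
qed

lemma tangent_vector_scale:
  assumes "u \<in> tangent_space M p"
  shows "r *\<^sub>t u \<in> tangent_space M p"
proof -
  obtain c where "c \<in> atlas M" "p \<in> fst c"
    using assms unfolding tangent_space_def by blast
  then show ?thesis using assms
    by (auto simp: tangent_space_chart dir_deriv_scaleR[symmetric])
qed

lemma tangent_vector_cong:
  assumes "u \<in> tangent_space M p" "openin (mtop M) W" "p \<in> W" "\<And>q. q \<in> W \<Longrightarrow> f q = g q"
  shows "u f = u g"
proof -
  obtain c h where c: "c \<in> atlas M" "p \<in> fst c" and u: "u = dir_deriv M c p h"
    using assms(1) unfolding tangent_space_def by blast
  \<comment> \<open>The test in \<open>dir_deriv\<close> must have the same outcome for both
    functions before their derivatives are compared.\<close>
  have "smooth_near M p f \<longleftrightarrow> smooth_near M p g"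
    using smooth_near_cong[OF _ assms(2,3), of f g] smooth_near_cong[OF _ assms(2,3), of g f] assms(4)
    by metis
  moreover have "frechet_derivative (f \<circ> chart_inv c) (at (snd c p)) =
      frechet_derivative (g \<circ> chart_inv c) (at (snd c p))"
    by (rule frechet_derivative_cong_on_open[OF open_chart_image_Int[OF c(1) assms(2)]])
      (use c assms in auto)
  ultimately show ?thesis by (simp add: u dir_deriv_def)
qed

text \<open>Smoothness of the summands matters: a tangent vector is 0 on non-smooth germs, although
  two of these can have a smooth sum.\<close>

lemma tangent_vector_sum_fun:
  assumes "u \<in> tangent_space M p" "smooth_near M p f" "smooth_near M p g"
  shows "u (\<lambda>q. f q + g q) = u f + u g"
proof -
  obtain c h where c: "c \<in> atlas M" "p \<in> fst c" and u: "u = dir_deriv M c p h"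
    using assms(1) unfolding tangent_space_def by blast
  show ?thesis
    using frechet_derivative_add[OF smooth_near_differentiable[OF assms(2) c]
        smooth_near_differentiable[OF assms(3) c]] assms
    by (simp add: u dir_deriv_def smooth_near_add o_def)
qed

text \<open>The Leibniz rule, the source of the extra derivative term that has to cancel when
  \<open>D3\<close> is shown to be tensorial.\<close>

lemma tangent_vector_mult_fun:
  assumes "u \<in> tangent_space M p" "smooth_near M p f" "smooth_near M p g"
  shows "u (\<lambda>q. f q * g q) = f p * u g + u f * g p"
proof -
  obtain c h where c: "c \<in> atlas M" "p \<in> fst c" and u: "u = dir_deriv M c p h"
    using assms(1) unfolding tangent_space_def by blast
  show ?thesis
    using frechet_derivative_mult[OF smooth_near_differentiable[OF assms(2) c]
        smooth_near_differentiable[OF assms(3) c]] assms c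
    by (simp add: u dir_deriv_def smooth_near_mult o_def)
qed

text \<open>In its own chart a coordinate function is a linear form, equal to its derivative.
  Coordinate functions therefore read off components, as \<open>trace_at\<close> does.\<close>

lemma dir_deriv_coord:
  assumes "c \<in> atlas M" "p \<in> fst c"
  shows "dir_deriv M c p h (\<lambda>q. snd c q \<bullet> b) = h \<bullet> b"
proof -
  have "frechet_derivative ((\<lambda>q. snd c q \<bullet> b) \<circ> chart_inv c) (at (snd c p)) =
      frechet_derivative (\<lambda>x. x \<bullet> b) (at (snd c p))"
    by (rule frechet_derivative_cong_on_open[OF open_chart_image[OF assms(1)]]) (use assms in auto)
  also have "\<dots> = (\<lambda>x. x \<bullet> b)"
    by (rule frechet_derivative_at[symmetric])
      (rule bounded_linear_imp_has_derivative[OF bounded_linear_inner_left])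
  finally show ?thesis by (simp add: dir_deriv_def smooth_near_coord assms)
qed

lemma tangent_vector_eq_dir_deriv:
  assumes "c \<in> atlas M" "p \<in> fst c" "u \<in> tangent_space M p"
  shows "u = dir_deriv M c p (\<Sum>b\<in>Basis. u (\<lambda>q. snd c q \<bullet> b) *\<^sub>R b)"
proof -
  obtain h where h: "u = dir_deriv M c p h"
    using assms tangent_space_chart by blast
  show ?thesis
    unfolding h dir_deriv_coord[OF assms(1,2)] by (simp add: euclidean_representation)
qed

lemma dir_deriv_sum:
  assumes "c \<in> atlas M" "p \<in> fst c" "finite B"
  shows "dir_deriv M c p (\<Sum>b\<in>B. r b *\<^sub>R b) = (\<Sum>b\<in>B. r b *\<^sub>t dir_deriv M c p b)"
  using assms(3)
proof induction
  case empty
  have "dir_deriv M c p 0 = 0"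
    using dir_deriv_scaleR[OF assms(1,2), of 0 0] by (simp add: tscale_def fun_eq_iff)
  then show ?case by simp
next
  case (insert b B)
  then show ?case by (simp add: dir_deriv_add dir_deriv_scaleR assms)
qed

lemma tangent_vector_expansion:
  assumes "c \<in> atlas M" "p \<in> fst c" "u \<in> tangent_space M p"
  shows "u = (\<Sum>b\<in>Basis. u (\<lambda>q. snd c q \<bullet> b) *\<^sub>t dir_deriv M c p b)"
  using tangent_vector_eq_dir_deriv[OF assms] dir_deriv_sum[OF assms(1,2) finite_Basis] by simp


section \<open>Vector fields\<close>

lemma vector_field_onD:
  assumes "vector_field_on M U X"
  shows "openin (mtop M) U" "p \<in> U \<Longrightarrow> X p \<in> tangent_space M p"
    "openin (mtop M) V \<Longrightarrow> V \<subseteq> U \<Longrightarrow> smooth_fun M V f \<Longrightarrow> smooth_fun M V (\<lambda>p. X p f)"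
  using assms unfolding vector_field_on_def by blast+

lemma vector_field_on_restrict:
  "vector_field_on M U X \<Longrightarrow> openin (mtop M) W \<Longrightarrow> W \<subseteq> U \<Longrightarrow> vector_field_on M W X"
  unfolding vector_field_on_def by blast

lemma vector_field_on_add:
  assumes "vector_field_on M U X" "vector_field_on M U Y"
  shows "vector_field_on M U (\<lambda>q. X q + Y q)"
  unfolding vector_field_on_def
  using vector_field_onD[OF assms(1)] vector_field_onD[OF assms(2)]
  by (auto intro: tangent_vector_add smooth_fun_add)

lemma vector_field_on_scale:
  assumes "vector_field_on M U X" "smooth_fun M U f"
  shows "vector_field_on M U (\<lambda>q. f q *\<^sub>t X q)"
proof -
  have "smooth_fun M V (\<lambda>q. (f q *\<^sub>t X q) F)"
    if "openin (mtop M) V" "V \<subseteq> U" "smooth_fun M V F" for V F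
    unfolding tscale_def
    by (rule smooth_fun_mult[OF that(1) smooth_fun_mono[OF assms(2) that(2)]
          vector_field_onD(3)[OF assms(1) that]])
  then show ?thesis
    unfolding vector_field_on_def
    using vector_field_onD(1,2)[OF assms(1)] by (auto intro: tangent_vector_scale)
qed

text \<open>In its own chart a coordinate field acts as a partial derivative, which preserves
  smoothness; any other chart adds a composition with a transition map.\<close>

lemma vector_field_on_coord_field:
  assumes c: "c \<in> atlas M"
  shows "vector_field_on M (fst c) (coord_field M c b)"
  unfolding vector_field_on_def
proof (intro conjI ballI allI impI)
  show "openin (mtop M) (fst c)" by (rule openin_chart[OF c])
  show "coord_field M c b p \<in> tangent_space M p" if "p \<in> fst c" for p
    using tangent_space_chart[OF c that] by (simp add: coord_field_def)
  fix W f
  assume "openin (mtop M) W \<and> W \<subseteq> fst c \<and> smooth_fun M W f"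
  then have W: "openin (mtop M) W" "W \<subseteq> fst c" and f: "smooth_fun M W f" by auto
  let ?F = "\<lambda>x. frechet_derivative (f \<circ> chart_inv c) (at x) b"
  have "smooth_fun M W (\<lambda>q. ?F (snd c q))"
  proof (rule smooth_funI)
    fix c' assume c': "c' \<in> atlas M"
    have "smooth_on (snd c' ` (W \<inter> fst c')) (\<lambda>x. ?F ((snd c \<circ> chart_inv c') x))"
    proof (rule smooth_on_compose[where T = "snd c \<circ> chart_inv c'" and f = ?F])
      show "open (snd c' ` (W \<inter> fst c'))" by (rule open_chart_image_Int[OF c' W(1)])
      show "smooth_on (snd c' ` (W \<inter> fst c')) (snd c \<circ> chart_inv c')"
        by (rule smooth_on_mono[OF transition_smooth[OF c' c]]) (use W in auto)
      show "(snd c \<circ> chart_inv c') ` snd c' ` (W \<inter> fst c') \<subseteq> snd c ` (W \<inter> fst c)"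
        using W c' by auto
      show "smooth_on (snd c ` (W \<inter> fst c)) ?F"
        by (rule smooth_on_frechet_derivative[OF smooth_funD[OF f c]])
    qed
    then show "smooth_on (snd c' ` (W \<inter> fst c')) ((\<lambda>q. ?F (snd c q)) \<circ> chart_inv c')"
      by (simp add: o_def)
  qed
  \<comment> \<open>The test in \<open>dir_deriv\<close> succeeds throughout \<open>W\<close>, since
    \<open>f\<close> is smooth on this neighbourhood of each of its points.\<close>
  then show "smooth_fun M W (\<lambda>q. coord_field M c b q f)"
    by (rule smooth_fun_cong[OF _ W(1)])
      (simp add: coord_field_def dir_deriv_def smooth_nearI[OF f W(1)])
qed

text \<open>Linearity over smooth functions on \<open>W\<close>, evaluated at \<open>p\<close>. The
  first clause is present because fields are total functions: \<open>\<Phi>\<close> may only look at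
  their values on \<open>W\<close>.\<close>

definition tensorial_at :: "'a \<Rightarrow> 'a set \<Rightarrow> ('a field \<Rightarrow> real) \<Rightarrow> bool" where
  "tensorial_at p W \<Phi> \<longleftrightarrow>
     (\<forall>X X'. vector_field_on M W X \<and> vector_field_on M W X' \<and> (\<forall>q\<in>W. X q = X' q) \<longrightarrow> \<Phi> X = \<Phi> X') \<and>
     (\<forall>X X'. vector_field_on M W X \<and> vector_field_on M W X' \<longrightarrow> \<Phi> (\<lambda>q. X q + X' q) = \<Phi> X + \<Phi> X') \<and>
     (\<forall>f X. smooth_fun M W f \<and> vector_field_on M W X \<longrightarrow> \<Phi> (\<lambda>q. f q *\<^sub>t X q) = f p * \<Phi> X)"

text \<open>On a subset of one chart domain the field is a combination of coordinate fields with
  smooth coefficients, and linearity over functions pulls the coefficients out with their values at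
  \<open>p\<close>.\<close>

lemma tensorial_at_expansion:
  assumes \<Phi>: "tensorial_at p W \<Phi>" and c: "c \<in> atlas M" and W: "W \<subseteq> fst c"
    and X: "vector_field_on M W X"
  shows "\<Phi> X = (\<Sum>b\<in>Basis. X p (\<lambda>q. snd c q \<bullet> b) * \<Phi> (coord_field M c b))"
proof -
  let ?f = "\<lambda>b q. X q (\<lambda>q. snd c q \<bullet> b)" and ?E = "coord_field M c"
  note o = vector_field_onD(1)[OF X]
  have E: "vector_field_on M W (?E b)" for b
    by (rule vector_field_on_restrict[OF vector_field_on_coord_field[OF c] o W])
  have f: "smooth_fun M W (?f b)" for b
    by (rule vector_field_onD(3)[OF X o _ smooth_fun_mono[OF smooth_fun_coord[OF c] W]]) simp
  \<comment> \<open>The partial sums are carried along as vector fields, because additivity of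
    \<open>\<Phi>\<close> applies only to such.\<close>
  have *: "vector_field_on M W (\<lambda>q. \<Sum>b\<in>B. ?f b q *\<^sub>t ?E b q) \<and>
      \<Phi> (\<lambda>q. \<Sum>b\<in>B. ?f b q *\<^sub>t ?E b q) = (\<Sum>b\<in>B. ?f b p * \<Phi> (?E b))" if "finite B" for B
    using that
  proof induction
    case empty
    \<comment> \<open>Writing the zero field as \<open>0\<close> times \<open>X\<close> shows that
      it is a field and that \<open>\<Phi>\<close> vanishes on it.\<close>
    have z: "(\<lambda>q. 0 *\<^sub>t X q) = (\<lambda>q. 0)" by (simp add: tscale_def fun_eq_iff)
    have "vector_field_on M W (\<lambda>q. 0 *\<^sub>t X q)" "\<Phi> (\<lambda>q. 0 *\<^sub>t X q) = 0 * \<Phi> X"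
      using vector_field_on_scale[OF X smooth_fun_const] \<Phi> X smooth_fun_const
      unfolding tensorial_at_def by blast+
    then show ?case by (simp add: z zero_fun_def)
  next
    case (insert b B)
    have t: "vector_field_on M W (\<lambda>q. ?f b q *\<^sub>t ?E b q)"
      by (rule vector_field_on_scale[OF E f])
    moreover have "\<Phi> (\<lambda>q. ?f b q *\<^sub>t ?E b q) = ?f b p * \<Phi> (?E b)"
      using \<Phi> f E unfolding tensorial_at_def by blast
    moreover have "\<Phi> (\<lambda>q. ?f b q *\<^sub>t ?E b q + (\<Sum>b\<in>B. ?f b q *\<^sub>t ?E b q)) =
        \<Phi> (\<lambda>q. ?f b q *\<^sub>t ?E b q) + \<Phi> (\<lambda>q. \<Sum>b\<in>B. ?f b q *\<^sub>t ?E b q)"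
      using \<Phi> t insert.IH unfolding tensorial_at_def by blast
    ultimately show ?case
      using insert.IH vector_field_on_add[OF t] by (simp only: sum.insert[OF insert.hyps])
  qed
  have "X q = (\<Sum>b\<in>Basis. ?f b q *\<^sub>t ?E b q)" if "q \<in> W" for q
    using tangent_vector_expansion[OF c _ vector_field_onD(2)[OF X that]] W that
    by (auto simp: coord_field_def)
  then have "\<Phi> X = \<Phi> (\<lambda>q. \<Sum>b\<in>Basis. ?f b q *\<^sub>t ?E b q)"
    using \<Phi> X *[OF finite_Basis] unfolding tensorial_at_def by blast
  then show ?thesis using *[OF finite_Basis] by simp
qed

end


section \<open>Quarter-symmetric curvature on a Kaehler manifold\<close>

lemma one_tscale [simp]: "1 *\<^sub>t u = u"
  by (simp add: tscale_def)

locale kaehler =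
  fixes M :: "('a, 'e::euclidean_space) mfd"
    and g :: "'a \<Rightarrow> 'a tvec \<Rightarrow> 'a tvec \<Rightarrow> real"
    and A :: "'a \<Rightarrow> 'a tvec \<Rightarrow> 'a tvec"
    and D :: "'a field \<Rightarrow> 'a field \<Rightarrow> 'a field"
  assumes kaehler: "kaehler_manifold M g A D"

sublocale kaehler \<subseteq> smooth_mfd M
  using kaehler by unfold_locales (simp add: kaehler_manifold_def)

context kaehler
begin

section \<open>Pointwise algebra of the complex structure and the metric\<close>

lemma vector_field_on_topspace: "vector_field_on M U X \<Longrightarrow> p \<in> U \<Longrightarrow> p \<in> topspace (mtop M)"
  using vector_field_onD(1) openin_subset by blast

lemma endomorphism: "endomorphism_field M A"
  using kaehler by (simp add: kaehler_manifold_def)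

lemma A_tangent: "p \<in> topspace (mtop M) \<Longrightarrow> u \<in> tangent_space M p \<Longrightarrow> A p u \<in> tangent_space M p"
  using endomorphism unfolding endomorphism_field_def by blast

lemma A_linear:
  assumes "p \<in> topspace (mtop M)" "u \<in> tangent_space M p" "v \<in> tangent_space M p"
  shows "A p (r *\<^sub>t u + s *\<^sub>t v) = r *\<^sub>t A p u + s *\<^sub>t A p v"
  using endomorphism assms unfolding endomorphism_field_def by blast

lemma A_add:
  assumes "p \<in> topspace (mtop M)" "u \<in> tangent_space M p" "v \<in> tangent_space M p"
  shows "A p (u + v) = A p u + A p v"
  using A_linear[OF assms, of 1 1] by simp

lemma A_scale:
  assumes "p \<in> topspace (mtop M)" "u \<in> tangent_space M p"
  shows "A p (r *\<^sub>t u) = r *\<^sub>t A p u"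
proof -
  have "r *\<^sub>t w + 0 *\<^sub>t w = r *\<^sub>t w" for w :: "'a tvec"
    by (simp add: tscale_def fun_eq_iff)
  then show ?thesis using A_linear[OF assms assms(2), of r 0] by simp
qed

lemma A_squared: "p \<in> topspace (mtop M) \<Longrightarrow> u \<in> tangent_space M p \<Longrightarrow> A p (A p u) = - u"
  using kaehler unfolding kaehler_manifold_def by blast

lemma metric: "riemannian_metric M g"
  using kaehler by (simp add: kaehler_manifold_def)

lemma g_sym:
  "p \<in> topspace (mtop M) \<Longrightarrow> u \<in> tangent_space M p \<Longrightarrow> v \<in> tangent_space M p \<Longrightarrow> g p u v = g p v u"
  by (rule metric[unfolded riemannian_metric_def, THEN conjunct1, rule_format])

lemma g_linear:
  assumes "p \<in> topspace (mtop M)" "u \<in> tangent_space M p" "v \<in> tangent_space M p" "w \<in> tangent_space M p"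
  shows "g p (r *\<^sub>t u + s *\<^sub>t v) w = r * g p u w + s * g p v w"
  by (rule metric[unfolded riemannian_metric_def, THEN conjunct2, THEN conjunct1, rule_format, OF assms])

lemma g_add:
  assumes "p \<in> topspace (mtop M)" "u \<in> tangent_space M p" "v \<in> tangent_space M p" "w \<in> tangent_space M p"
  shows "g p (u + v) w = g p u w + g p v w"
  using g_linear[OF assms, of 1 1] by simp

lemma g_scale:
  assumes "p \<in> topspace (mtop M)" "u \<in> tangent_space M p" "w \<in> tangent_space M p"
  shows "g p (r *\<^sub>t u) w = r * g p u w"
proof -
  have "r *\<^sub>t u + 0 *\<^sub>t u = r *\<^sub>t u"
    by (simp add: tscale_def fun_eq_iff)
  then show ?thesis using g_linear[OF assms(1,2,2,3), of r 0] by simp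
qed

lemma g_pos: "p \<in> topspace (mtop M) \<Longrightarrow> u \<in> tangent_space M p \<Longrightarrow> u \<noteq> 0 \<Longrightarrow> 0 < g p u u"
  by (rule metric[unfolded riemannian_metric_def, THEN conjunct2, THEN conjunct2, THEN conjunct1,
        rule_format])

lemma g_A_A:
  "p \<in> topspace (mtop M) \<Longrightarrow> u \<in> tangent_space M p \<Longrightarrow> v \<in> tangent_space M p
    \<Longrightarrow> g p (A p u) (A p v) = g p u v"
  using kaehler unfolding kaehler_manifold_def by blast

text \<open>The isometry property for \<open>A p u\<close> and \<open>v\<close>, combined with
  \<open>A^2 = -I\<close>.\<close>

lemma g_A_skew:
  assumes "p \<in> topspace (mtop M)" "u \<in> tangent_space M p" "v \<in> tangent_space M p"
  shows "g p (A p u) v = - g p u (A p v)"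
proof -
  have "- u = (-1) *\<^sub>t u"
    by (simp add: tscale_def fun_eq_iff)
  then show ?thesis
    using g_A_A[OF assms(1) A_tangent[OF assms(1,2)] assms(3)] A_squared[OF assms(1,2)]
      g_scale[OF assms(1,2) A_tangent[OF assms(1,3)], of "-1"] by simp
qed

text \<open>Coordinates transport \<open>A\<close> and \<open>g\<close> at \<open>p\<close> to the
  model space, where the metric becomes a positive form for which the matrix of \<open>A\<close> is
  skew; \<open>trace_skew_eq_0\<close> then applies.\<close>

lemma trace_A:
  assumes c: "c \<in> atlas M" "p \<in> fst c"
  shows "(\<Sum>b\<in>Basis. A p (coord_field M c b p) (\<lambda>q. snd c q \<bullet> b)) = 0"
proof -
  define d where "d = dir_deriv M c p"
  \<comment> \<open>\<open>a\<close> is the matrix of \<open>A\<close> at \<open>p\<close> in the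
    coordinates of \<open>c\<close>, viewed as a map of the model space.\<close>
  define a where "a h = (\<Sum>b\<in>Basis. A p (d h) (\<lambda>q. snd c q \<bullet> b) *\<^sub>R b)" for h
  have p: "p \<in> topspace (mtop M)"
    using openin_subset[OF openin_chart[OF c(1)]] c(2) by blast
  have d: "d h \<in> tangent_space M p" for h
    using tangent_space_chart[OF c] by (simp add: d_def)
  have d_add: "d (h + k) = d h + d k" and d_scale: "d (r *\<^sub>R h) = r *\<^sub>t d h" for h k r
    by (simp_all add: d_def dir_deriv_add dir_deriv_scaleR c)
  have Ad: "A p (d h) = d (a h)" for h
    using tangent_vector_eq_dir_deriv[OF c A_tangent[OF p d]] by (simp add: a_def d_def)
  have "(\<Sum>b\<in>Basis. a b \<bullet> b) = 0"
  proof (rule trace_skew_eq_0[of a "\<lambda>h k. g p (d h) (d k)"])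
    show "linear a"
      by (rule linearI) (simp_all add: a_def d_add d_scale A_add[OF p d d] A_scale[OF p d],
          simp_all add: tscale_def scaleR_left_distrib sum.distrib scaleR_sum_right)
    show lin: "linear (\<lambda>h. g p (d h) (d k))" for k
      by (rule linearI) (simp_all add: d_add d_scale g_add[OF p d d d] g_scale[OF p d d])
    show "linear (\<lambda>k. g p (d h) (d k))" for h
      using lin[of h] by (simp add: g_sym[OF p d d])
    show "0 < g p (d h) (d h)" if h: "h \<noteq> 0" for h
    proof (rule g_pos[OF p d])
      \<comment> \<open>Positivity needs \<open>d\<close> to be injective: some coordinate function
        detects a nonzero component of \<open>h\<close>.\<close>
      obtain b where "b \<in> Basis" "h \<bullet> b \<noteq> 0"
        using h euclidean_all_zero_iff[of h] by blast
      then have "d h (\<lambda>q. snd c q \<bullet> b) \<noteq> 0"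
        by (simp add: d_def dir_deriv_coord[OF c])
      then show "d h \<noteq> 0" by auto
    qed
    show "g p (d (a h)) (d k) = - g p (d h) (d (a k))" for h k
      using g_A_skew[OF p d d] by (simp add: Ad)
  qed
  moreover have "A p (d b) (\<lambda>q. snd c q \<bullet> b) = a b \<bullet> b" for b
    unfolding Ad by (simp add: d_def dir_deriv_coord[OF c])
  ultimately show ?thesis by (simp add: coord_field_def d_def)
qed

section \<open>Rules of the Levi-Civita connection\<close>

lemma affine: "affine_connection M D"
  using kaehler by (simp add: kaehler_manifold_def levi_civita_connection_def)

lemma D_vector_field:
  "vector_field_on M U X \<Longrightarrow> vector_field_on M U Y \<Longrightarrow> vector_field_on M U (D X Y)"
  by (rule affine[unfolded affine_connection_def, THEN conjunct1, rule_format, OF conjI])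

lemma D_cong:
  assumes "vector_field_on M U X" "vector_field_on M U X'" "vector_field_on M U Y" "vector_field_on M U Y'"
    and "\<And>q. q \<in> U \<Longrightarrow> X q = X' q" "\<And>q. q \<in> U \<Longrightarrow> Y q = Y' q" "p \<in> U"
  shows "D X Y p = D X' Y' p"
  by (rule affine[unfolded affine_connection_def, THEN conjunct2, THEN conjunct1, rule_format,
        OF _ assms(7)]) (use assms in blast)

lemma D_add_left:
  assumes "vector_field_on M U X" "vector_field_on M U X'" "vector_field_on M U Y" "p \<in> U"
  shows "D (\<lambda>q. X q + X' q) Y p = D X Y p + D X' Y p"
  by (rule affine[unfolded affine_connection_def, THEN conjunct2, THEN conjunct2, THEN conjunct1, rule_format,
        OF conjI[OF assms(1) conjI[OF assms(2,3)]] assms(4)])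

lemma D_scale_left:
  assumes "smooth_fun M U f" "vector_field_on M U X" "vector_field_on M U Y" "p \<in> U"
  shows "D (\<lambda>q. f q *\<^sub>t X q) Y p = f p *\<^sub>t D X Y p"
  by (rule affine[unfolded affine_connection_def, THEN conjunct2, THEN conjunct2, THEN conjunct2, THEN conjunct1, rule_format,
        OF conjI[OF assms(1) conjI[OF assms(2,3)]] assms(4)])

lemma D_add_right:
  assumes "vector_field_on M U X" "vector_field_on M U Y" "vector_field_on M U Y'" "p \<in> U"
  shows "D X (\<lambda>q. Y q + Y' q) p = D X Y p + D X Y' p"
  by (rule affine[unfolded affine_connection_def, THEN conjunct2, THEN conjunct2, THEN conjunct2, THEN conjunct2, THEN conjunct1, rule_format,
        OF conjI[OF assms(1) conjI[OF assms(2,3)]] assms(4)])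

lemma D_scale_right:
  assumes "smooth_fun M U f" "vector_field_on M U X" "vector_field_on M U Y" "p \<in> U"
  shows "D X (\<lambda>q. f q *\<^sub>t Y q) p = X p f *\<^sub>t Y p + f p *\<^sub>t D X Y p"
  by (rule affine[unfolded affine_connection_def, THEN conjunct2, THEN conjunct2, THEN conjunct2, THEN conjunct2, THEN conjunct2, rule_format,
        OF conjI[OF assms(1) conjI[OF assms(2,3)]] assms(4)])

end

section \<open>The generator, and tensoriality of \<open>D2\<close> and \<open>D3\<close>\<close>

locale kaehler_generator = kaehler M g A D
  for M :: "('a, 'e::euclidean_space) mfd" and g A D +
  fixes \<pi> :: "'a \<Rightarrow> 'a tvec \<Rightarrow> real"
  assumes one_form: "one_form M \<pi>"
begin

lemma form_linear:
  assumes "p \<in> topspace (mtop M)" "u \<in> tangent_space M p" "v \<in> tangent_space M p"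
  shows "\<pi> p (r *\<^sub>t u + s *\<^sub>t v) = r * \<pi> p u + s * \<pi> p v"
  using one_form assms unfolding one_form_def by blast

lemma form_add:
  assumes "p \<in> topspace (mtop M)" "u \<in> tangent_space M p" "v \<in> tangent_space M p"
  shows "\<pi> p (u + v) = \<pi> p u + \<pi> p v"
  using form_linear[OF assms, of 1 1] by simp

lemma form_scale:
  assumes "p \<in> topspace (mtop M)" "u \<in> tangent_space M p"
  shows "\<pi> p (r *\<^sub>t u) = r * \<pi> p u"
proof -
  have "r *\<^sub>t u + 0 *\<^sub>t u = r *\<^sub>t u"
    by (simp add: tscale_def fun_eq_iff)
  then show ?thesis using form_linear[OF assms assms(2), of r 0] by simp
qed

lemma form_smooth: "vector_field_on M U X \<Longrightarrow> smooth_fun M U (\<lambda>q. \<pi> q (X q))"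
  using one_form unfolding one_form_def by blast

text \<open>The first argument is never differentiated: it enters as a derivation, as the direction
  of \<open>D\<close> and through \<open>A\<close>, each time linearly over functions.\<close>

lemma tensorial_at_D2:
  assumes Y: "vector_field_on M W Y" and p: "p \<in> W"
  shows "tensorial_at p W (\<lambda>X. D2 D A \<pi> X Y p)"
proof -
  note top = vector_field_on_topspace[OF Y p]
  note tan = vector_field_onD(2)[OF _ p]
  note defs = D2_def cov_deriv_form_def
  have "D2 D A \<pi> X Y p = D2 D A \<pi> X' Y p"
    if X: "vector_field_on M W X" "vector_field_on M W X'" "\<And>q. q \<in> W \<Longrightarrow> X q = X' q" for X X'
    using D_cong[OF X(1,2) Y Y X(3) refl p] X(3)[OF p] by (simp add: defs)
  moreover have "D2 D A \<pi> (\<lambda>q. X q + X' q) Y p = D2 D A \<pi> X Y p + D2 D A \<pi> X' Y p"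
    if X: "vector_field_on M W X" "vector_field_on M W X'" for X X'
    using tan[OF X(1)] tan[OF X(2)] tan[OF D_vector_field[OF X(1) Y]] tan[OF D_vector_field[OF X(2) Y]]
    by (simp add: defs D_add_left[OF X Y p] A_add top form_add A_tangent) (simp add: algebra_simps)
  moreover have "D2 D A \<pi> (\<lambda>q. f q *\<^sub>t X q) Y p = f p * D2 D A \<pi> X Y p"
    if f: "smooth_fun M W f" and X: "vector_field_on M W X" for f X
    using tan[OF X] tan[OF D_vector_field[OF X Y]]
    by (simp add: defs D_scale_left[OF f X Y p] A_scale top form_scale A_tangent)
      (simp add: tscale_def algebra_simps)
  ultimately show ?thesis unfolding tensorial_at_def by blast
qed

text \<open>The second argument is differentiated twice over, by \<open>Y\<close> inside
  \<open>\<pi>(Z)\<close> and by \<open>D\<close>. Scaling \<open>Z\<close> by \<open>f\<close>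
  produces \<open>Y(f) \<pi>(Z)\<close> in both places, with opposite signs.\<close>

lemma tensorial_at_D3:
  assumes Y: "vector_field_on M W Y" and p: "p \<in> W"
  shows "tensorial_at p W (\<lambda>Z. D3 D A \<pi> Y Z p)"
proof -
  note op = vector_field_onD(1)[OF Y]
  note top = vector_field_on_topspace[OF Y]
  note tan = vector_field_onD(2)
  note defs = D3_def cov_deriv_form_def
  note Yp = tan[OF Y p]
  have near: "smooth_near M p (\<lambda>q. \<pi> q (Z q))" if "vector_field_on M W Z" for Z
    by (rule smooth_nearI[OF form_smooth[OF that] op p])
  have "D3 D A \<pi> Y Z p = D3 D A \<pi> Y Z' p"
    if Z: "vector_field_on M W Z" "vector_field_on M W Z'" "\<And>q. q \<in> W \<Longrightarrow> Z q = Z' q" for Z Z'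
  proof -
    have "Y p (\<lambda>q. \<pi> q (Z q)) = Y p (\<lambda>q. \<pi> q (Z' q))"
      by (rule tangent_vector_cong[OF Yp op p]) (simp add: Z(3))
    then show ?thesis
      using D_cong[OF Y Y Z(1,2) refl Z(3) p] Z(3)[OF p] by (simp add: defs)
  qed
  moreover have "D3 D A \<pi> Y (\<lambda>q. Z q + Z' q) p = D3 D A \<pi> Y Z p + D3 D A \<pi> Y Z' p"
    if Z: "vector_field_on M W Z" "vector_field_on M W Z'" for Z Z'
  proof -
    \<comment> \<open>Linearity of \<open>\<pi>\<close> is known only on tangent vectors, so the two
      functions agree on \<open>W\<close> and are compared as germs.\<close>
    have "Y p (\<lambda>q. \<pi> q (Z q + Z' q)) = Y p (\<lambda>q. \<pi> q (Z q) + \<pi> q (Z' q))"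
      by (rule tangent_vector_cong[OF Yp op p]) (simp add: form_add top tan[OF Z(1)] tan[OF Z(2)])
    also have "\<dots> = Y p (\<lambda>q. \<pi> q (Z q)) + Y p (\<lambda>q. \<pi> q (Z' q))"
      by (rule tangent_vector_sum_fun[OF Yp near[OF Z(1)] near[OF Z(2)]])
    finally show ?thesis
      using tan[OF Z(1) p] tan[OF Z(2) p] tan[OF D_vector_field[OF Y Z(1)] p]
        tan[OF D_vector_field[OF Y Z(2)] p] top[OF p]
      by (simp add: defs D_add_right[OF Y Z p] A_add form_add A_tangent) (simp add: algebra_simps)
  qed
  moreover have "D3 D A \<pi> Y (\<lambda>q. f q *\<^sub>t Z q) p = f p * D3 D A \<pi> Y Z p"
    if f: "smooth_fun M W f" and Z: "vector_field_on M W Z" for f Z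
  proof -
    have "Y p (\<lambda>q. \<pi> q (f q *\<^sub>t Z q)) = Y p (\<lambda>q. f q * \<pi> q (Z q))"
      by (rule tangent_vector_cong[OF Yp op p]) (simp add: form_scale top tan[OF Z])
    also have "\<dots> = f p * Y p (\<lambda>q. \<pi> q (Z q)) + Y p f * \<pi> p (Z p)"
      by (rule tangent_vector_mult_fun[OF Yp smooth_nearI[OF f op p] near[OF Z]])
    finally show ?thesis
      using tan[OF Z p] tan[OF D_vector_field[OF Y Z] p] top[OF p]
      by (simp add: defs D_scale_right[OF f Y Z p] A_scale form_linear form_scale A_tangent) (simp add: algebra_simps)
  qed
  ultimately show ?thesis unfolding tensorial_at_def by blast
qed

text \<open>With \<open>E\<close> the traced argument, \<open>A^2 = -I\<close> turns
  \<open>- D2(E, Y) A(AX)\<close> into \<open>D2(E, Y) X\<close>, whose trace is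
  \<open>D2(X, Y)\<close> by tensoriality. The remaining term is a multiple of the trace of
  \<open>A\<close>.\<close>

lemma ricci3_A:
  assumes X: "vector_field_on M U X" and Y: "vector_field_on M U Y" and p: "p \<in> U"
  shows "ricci3 M D A \<pi> Y (\<lambda>q. A q (X q)) p =
    trace_at M p (\<lambda>E. curvature M D E Y (\<lambda>q. A q (X q))) + D2 D A \<pi> X Y p"
proof -
  define c where "c = chart_at M p"
  \<comment> \<open>On this set the given fields and the coordinate fields of the chart chosen by
    \<open>trace_at\<close> are all defined.\<close>
  let ?W = "U \<inter> fst c"
  have top: "p \<in> topspace (mtop M)" by (rule vector_field_on_topspace[OF X p])
  then have c: "c \<in> atlas M" "p \<in> fst c" unfolding c_def by (rule chart_at)+
  have W: "openin (mtop M) ?W"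
    by (rule openin_Int[OF vector_field_onD(1)[OF X] openin_chart[OF c(1)]])
  have "D2 D A \<pi> X Y p = (\<Sum>b\<in>Basis. X p (\<lambda>q. snd c q \<bullet> b) * D2 D A \<pi> (coord_field M c b) Y p)"
    by (rule tensorial_at_expansion[OF tensorial_at_D2[of ?W] c(1)])
      (use X Y p c W in \<open>auto intro: vector_field_on_restrict\<close>)
  then show ?thesis
    using trace_A[OF c] A_squared[OF top vector_field_onD(2)[OF X p]]
    by (simp add: ricci3_def trace_at_def curvature3_def tscale_def c_def[symmetric] Let_def
        sum.distrib sum_distrib_left[symmetric] mult.commute)
qed

text \<open>Here the \<open>D2\<close> term is the multiple of the trace of \<open>A\<close>, while
  \<open>D3(Y, E) A(AZ)\<close> equals \<open>- D3(Y, E) Z\<close> and is traced by tensoriality in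
  the second argument.\<close>

lemma prime_curvature3_A:
  assumes Y: "vector_field_on M U Y" and Z: "vector_field_on M U Z" and p: "p \<in> U"
  shows "prime_curvature3 M D A \<pi> (\<lambda>q. A q (Z q)) Y p =
    trace_at M p (\<lambda>E. curvature M D (\<lambda>q. A q (Z q)) Y E) - D3 D A \<pi> Y Z p"
proof -
  define c where "c = chart_at M p"
  let ?W = "U \<inter> fst c"
  have top: "p \<in> topspace (mtop M)" by (rule vector_field_on_topspace[OF Z p])
  then have c: "c \<in> atlas M" "p \<in> fst c" unfolding c_def by (rule chart_at)+
  have W: "openin (mtop M) ?W"
    by (rule openin_Int[OF vector_field_onD(1)[OF Z] openin_chart[OF c(1)]])
  have "D3 D A \<pi> Y Z p = (\<Sum>b\<in>Basis. Z p (\<lambda>q. snd c q \<bullet> b) * D3 D A \<pi> Y (coord_field M c b) p)"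
    by (rule tensorial_at_expansion[OF tensorial_at_D3[of ?W] c(1)])
      (use Z Y p c W in \<open>auto intro: vector_field_on_restrict\<close>)
  then show ?thesis
    using trace_A[OF c] A_squared[OF top vector_field_onD(2)[OF Z p]]
    by (simp add: prime_curvature3_def trace_at_def curvature3_def tscale_def c_def[symmetric] Let_def
        sum.distrib sum_subtractf sum_negf sum_distrib_left[symmetric] mult.commute)
qed

text \<open>The \<open>D2\<close> and \<open>D3\<close> contributions of the two traces cancel those
  of the curvature, leaving the same expression formed from the Riemannian curvature, free of
  \<open>\<pi>\<close>.\<close>

lemma H3_eq:
  assumes "vector_field_on M U X" "vector_field_on M U Y" "vector_field_on M U Z" "p \<in> U"
  shows "H3 M D A \<pi> X Y Z p = curvature M D X Y Z p
    + trace_at M p (\<lambda>E. curvature M D E Y (\<lambda>q. A q (X q))) *\<^sub>t A p (Z p)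
    + trace_at M p (\<lambda>E. curvature M D (\<lambda>q. A q (Z q)) Y E) *\<^sub>t A p (X p)"
  unfolding H3_def ricci3_A[OF assms(1,2,4)] prime_curvature3_A[OF assms(2,3,4)] curvature3_def
  by (simp add: fun_eq_iff tscale_def algebra_simps)

end

theorem theorem4p5:
  fixes M :: "('a, 'e::euclidean_space) mfd"
    and g :: "'a \<Rightarrow> 'a tvec \<Rightarrow> 'a tvec \<Rightarrow> real"
    and A :: "'a \<Rightarrow> 'a tvec \<Rightarrow> 'a tvec"
    and D D1 D1' :: "'a field \<Rightarrow> 'a field \<Rightarrow> 'a field"
    and \<pi> \<pi>' :: "'a \<Rightarrow> 'a tvec \<Rightarrow> real"
  assumes "kaehler_manifold M g A D"
    and "one_form M \<pi>" and "quarter_symmetric_connection M A D \<pi> D1"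
    and "one_form M \<pi>'" and "quarter_symmetric_connection M A D \<pi>' D1'"
  shows "\<forall>U X Y Z. vector_field_on M U X \<and> vector_field_on M U Y \<and> vector_field_on M U Z \<longrightarrow>
           (\<forall>p\<in>U. H3 M D A \<pi> X Y Z p = H3 M D A \<pi>' X Y Z p)"
proof -
  interpret P: kaehler_generator M g A D \<pi>
    by unfold_locales (fact assms)+
  interpret P': kaehler_generator M g A D \<pi>'
    by unfold_locales (fact assms)+
  show ?thesis
  proof (intro allI impI ballI, elim conjE)
    fix U X Y Z p
    assume *: "vector_field_on M U X" "vector_field_on M U Y" "vector_field_on M U Z" "p \<in> U"
    show "H3 M D A \<pi> X Y Z p = H3 M D A \<pi>' X Y Z p"
      \<comment> \<open>Both generators lead to the same expression in \<open>M\<close>,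
        \<open>D\<close> and \<open>A\<close>.\<close>
      by (rule trans[OF P.H3_eq[OF *] P'.H3_eq[OF *, symmetric]])
  qed
qed

end
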